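(* Let $(V,b,m)$ be an infinite, locally finite, connected graph over a non-Archimedean ordered field $\mathbb K$ which is Cauchy complete and has countable cofinality. Let $(K_n)$ be an exhaustion of $V$ and let $a\in V$ be a fixed vertex. For $x,y\in V$ put $G_n(x,y)=\Delta_{K_n}^{-1}1_y(x)$ (for all $n$ so large that $y\in K_n$). Then $$\mathrm{cap}(a)=\lim_{n\to\infty}\frac{m(a)}{G_n(a,a)}$$ when either side exists. Furthermore: (1) The graph has null capacity if and only if $\lim_{n\to\infty}G_n(x,y)=\infty$ for some (equivalently, all) $x,y\in V$. (2) The graph has positive capacity if and only if $\lim_{n\to\infty}G_n(x,y)$ exists in $\mathbb K$ for some (equivalently, all) $x,y\in V$. (3) The graph has divergent capacity if and only if $\lim_{n\to\infty}G_n(x,y)$ does not exist (neither in $\mathbb K$ nor as $\infty$) for some (equivalently, all) $x,y\in V$. Moreover, in the positive capacity case, with $G(x,y)=\lim_{n\to\infty}G_n(x,y)$, the function $G(\cdot,a)$ is the smallest positive solution $u:V\to\mathbb K$ of $\Delta u=1_a$ (i.e. it is a positive solution, and $u\succeq G(\cdot,a)$ pointwise for every positive solution $u$).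
   Context: An ordered field $(\mathbb K,\succ)$ is non-Archimedean if there is $\tau\succ0$ with $\tau\prec 1/n$ for all $n\in\mathbb N$. $\mathbb K^+=\{k\in\mathbb K: k\succ0\}$. A sequence $(k_n)$ converges to $k\in\mathbb K$ if for every $c\in\mathbb K^+$ one has $|k_n-k|\preceq c$ for all large $n$, and $k_n\to\infty$ means that for every $c\in\mathbb K$ one has $k_n\succ c$ for all large $n$. Cauchy complete: every Cauchy sequence converges. Countable cofinality: there is a countable $S\subset\mathbb K$ such that every $k\in\mathbb K$ satisfies $k\preceq s$ for some $s\in S$. A graph $(V,b,m)$ over $\mathbb K$: $V$ is an at most countable set, $m:V\to\mathbb K^+$, and $b:V\times V\to\mathbb K^+\cup\{0\}$ is symmetric with $b(x,x)=0$. Write $x\sim y$ if $b(x,y)\neq0$; locally finite means each vertex has finitely many neighbors; connectedness (of $V$, or of a subset $K$ via paths inside $K$) is with respect to paths $x_0\sim x_1\sim\dots\sim x_n$, and $d$ is the combinatorial graph distance. $B_n(a)=\{x\in V: d(a,x)<n\}$. An exhaustion is a sequence of finite sets $K_n\subset V$, $n\in\mathbb N_0$, with $K_n\subset K_{n+1}$ for all $n$ and $V=\bigcup_n K_n$. Laplacian: $\Delta f(x)=\frac1{m(x)}\sum_{y\in V}(f(x)-f(y))b(x,y)$ for $f:V\to\mathbb K$. For finite $K\subseteq V$, $\Delta_K:C(K)\to C(K)$ ($C(K)$ the functions $K\to\mathbb K$) extends $f$ by $0$ to $V$, applies $\Delta$, and restricts to $K$; on an infinite connected graph it is invertible, $\Delta_K^{-1}$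 denotes its inverse, and functions $\Delta_K^{-1}f$ are extended by $0$ to $V$. $1_y$ is the function equal to $1$ at $y$ and $0$ elsewhere. A function is positive if it takes values in $\mathbb K^+\cup\{0\}$. For a finite connected $K\subseteq V$ and $a\in K$ there is a unique $v:V\to\mathbb K$ with $\Delta v=0$ on $K\setminus\{a\}$, $v(a)=1$, $v=0$ on $V\setminus K$; put $\mathrm{cap}_K(a)=\Delta v(a)m(a)$ and $\mathrm{cap}_n(a)=\mathrm{cap}_{B_n(a)}(a)$, $n\ge1$. The effective capacity is $\mathrm{cap}(a)=\lim_{n\to\infty}\mathrm{cap}_n(a)$ if this limit exists in $\mathbb K$. The graph has null capacity if $\mathrm{cap}(a)=0$, positive capacity if $\mathrm{cap}(a)$ exists and is $\neq0$, divergent capacity if $\mathrm{cap}(a)$ does not exist, for some (equivalently, all) $a\in V$. *)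

theory Defs
  imports Main "HOL-Library.Countable_Set" "HOL-Library.Indicator_Function"
begin

section \<open>Ordered fields\<close>

text \<open>
  The class \<^class>\<open>linordered_field\<close> carries no topology, so convergence is
  spelled out. Divergence to infinity is \<^term>\<open>filterlim s at_top sequentially\<close>.
\<close>

definition non_archimedean :: "'k::linordered_field itself \<Rightarrow> bool" where
  "non_archimedean _ \<longleftrightarrow> (\<exists>\<tau>::'k. 0 < \<tau> \<and> (\<forall>n::nat. n \<ge> 1 \<longrightarrow> \<tau> < 1 / of_nat n))"

definition converges_to :: "(nat \<Rightarrow> 'k::linordered_field) \<Rightarrow> 'k \<Rightarrow> bool" where
  "converges_to s l \<longleftrightarrow> (\<forall>c>0. \<forall>\<^sub>F n in sequentially. \<bar>s n - l\<bar> \<le> c)"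

definition is_cauchy :: "(nat \<Rightarrow> 'k::linordered_field) \<Rightarrow> bool" where
  "is_cauchy s \<longleftrightarrow> (\<forall>c>0. \<exists>N. \<forall>i\<ge>N. \<forall>j\<ge>N. \<bar>s i - s j\<bar> \<le> c)"

definition cauchy_complete :: "'k::linordered_field itself \<Rightarrow> bool" where
  "cauchy_complete _ \<longleftrightarrow> (\<forall>s :: nat \<Rightarrow> 'k. is_cauchy s \<longrightarrow> (\<exists>l. converges_to s l))"

definition countable_cofinality :: "'k::linordered_field itself \<Rightarrow> bool" where
  "countable_cofinality _ \<longleftrightarrow> (\<exists>S :: 'k set. countable S \<and> (\<forall>k. \<exists>s\<in>S. k \<le> s))"

section \<open>Graphs over an ordered field\<close>

text \<open>The vertex set is the whole type \<^typ>\<open>'v\<close>.\<close>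

locale weighted_graph =
  fixes b :: "'v \<Rightarrow> 'v \<Rightarrow> 'k::linordered_field"
    and m :: "'v \<Rightarrow> 'k"
  assumes countable_vertices: "countable (UNIV :: 'v set)"
    and measure_pos: "\<And>x. 0 < m x"
    and weight_nonneg: "\<And>x y. 0 \<le> b x y"
    and weight_sym: "\<And>x y. b x y = b y x"
    and weight_no_loop: "\<And>x. b x x = 0"

definition adjacent :: "('v \<Rightarrow> 'v \<Rightarrow> 'k::linordered_field) \<Rightarrow> 'v \<Rightarrow> 'v \<Rightarrow> bool" where
  "adjacent b x y \<longleftrightarrow> b x y \<noteq> 0"

definition locally_finite_graph :: "('v \<Rightarrow> 'v \<Rightarrow> 'k::linordered_field) \<Rightarrow> bool" where
  "locally_finite_graph b \<longleftrightarrow> (\<forall>x. finite {y. adjacent b x y})"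

definition connected_graph :: "('v \<Rightarrow> 'v \<Rightarrow> 'k::linordered_field) \<Rightarrow> bool" where
  "connected_graph b \<longleftrightarrow> (\<forall>x y. (adjacent b)\<^sup>*\<^sup>* x y)"

text \<open>The length of a shortest path; only meaningful if some path joins the two vertices.\<close>

definition graph_dist :: "('v \<Rightarrow> 'v \<Rightarrow> 'k::linordered_field) \<Rightarrow> 'v \<Rightarrow> 'v \<Rightarrow> nat" where
  "graph_dist b x y = (LEAST n. (adjacent b ^^ n) x y)"

definition graph_ball :: "('v \<Rightarrow> 'v \<Rightarrow> 'k::linordered_field) \<Rightarrow> 'v \<Rightarrow> nat \<Rightarrow> 'v set" where
  "graph_ball b a n = {x. graph_dist b a x < n}"

definition exhaustion :: "(nat \<Rightarrow> 'v set) \<Rightarrow> bool" where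
  "exhaustion K \<longleftrightarrow> (\<forall>n. finite (K n)) \<and> (\<forall>n. K n \<subseteq> K (Suc n)) \<and> (\<Union>n. K n) = UNIV"

section \<open>Laplacian, Green function and capacity\<close>

text \<open>
  The sum over all vertices is restricted to the neighbours of \<^term>\<open>x\<close>, where the
  other summands vanish: \<^const>\<open>sum\<close> over an infinite set is always \<^term>\<open>0\<close>.
\<close>

definition laplacian ::
  "('v \<Rightarrow> 'v \<Rightarrow> 'k::linordered_field) \<Rightarrow> ('v \<Rightarrow> 'k) \<Rightarrow> ('v \<Rightarrow> 'k) \<Rightarrow> 'v \<Rightarrow> 'k" where
  "laplacian b m f x = 1 / m x * (\<Sum>y | adjacent b x y. (f x - f y) * b x y)"

text \<open>
  Functions on a set \<^term>\<open>K\<close> are represented by their extensions by \<^term>\<open>0\<close>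
  to all vertices.
\<close>

definition functions_on :: "'v set \<Rightarrow> ('v \<Rightarrow> 'k::linordered_field) set" where
  "functions_on K = {f. \<forall>x. x \<notin> K \<longrightarrow> f x = 0}"

definition laplacian_on ::
  "('v \<Rightarrow> 'v \<Rightarrow> 'k::linordered_field) \<Rightarrow> ('v \<Rightarrow> 'k) \<Rightarrow> 'v set \<Rightarrow> ('v \<Rightarrow> 'k) \<Rightarrow> 'v \<Rightarrow> 'k" where
  "laplacian_on b m K f = (\<lambda>x. if x \<in> K then laplacian b m f x else 0)"

text \<open>
  For finite \<^term>\<open>K\<close> in an infinite, locally finite, connected graph, the operator
  \<^term>\<open>laplacian_on b m K\<close> is a bijection of \<^term>\<open>functions_on K\<close>, and
  \<^const>\<open>inv_into\<close> is its inverse.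
\<close>

definition laplacian_inv ::
  "('v \<Rightarrow> 'v \<Rightarrow> 'k::linordered_field) \<Rightarrow> ('v \<Rightarrow> 'k) \<Rightarrow> 'v set \<Rightarrow> ('v \<Rightarrow> 'k) \<Rightarrow> 'v \<Rightarrow> 'k" where
  "laplacian_inv b m K = inv_into (functions_on K) (laplacian_on b m K)"

text \<open>Unspecified unless \<^term>\<open>y \<in> K\<close>, since otherwise the indicator is not a function on
  \<^term>\<open>K\<close>.\<close>

definition green ::
  "('v \<Rightarrow> 'v \<Rightarrow> 'k::linordered_field) \<Rightarrow> ('v \<Rightarrow> 'k) \<Rightarrow> 'v set \<Rightarrow> 'v \<Rightarrow> 'v \<Rightarrow> 'k" where
  "green b m K x y = laplacian_inv b m K (indicator {y}) x"

text \<open>Well-defined for finite connected \<^term>\<open>K\<close> containing \<^term>\<open>a\<close>.\<close>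

definition equilibrium_potential ::
  "('v \<Rightarrow> 'v \<Rightarrow> 'k::linordered_field) \<Rightarrow> ('v \<Rightarrow> 'k) \<Rightarrow> 'v set \<Rightarrow> 'v \<Rightarrow> 'v \<Rightarrow> 'k" where
  "equilibrium_potential b m K a =
    (THE v. (\<forall>x \<in> K - {a}. laplacian b m v x = 0) \<and> v a = 1 \<and> (\<forall>x. x \<notin> K \<longrightarrow> v x = 0))"

definition cap_on ::
  "('v \<Rightarrow> 'v \<Rightarrow> 'k::linordered_field) \<Rightarrow> ('v \<Rightarrow> 'k) \<Rightarrow> 'v set \<Rightarrow> 'v \<Rightarrow> 'k" where
  "cap_on b m K a = laplacian b m (equilibrium_potential b m K a) a * m a"

text \<open>
  The effective capacity at \<^term>\<open>a\<close> exists and equals \<^term>\<open>c\<close>. The ball of radius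
  \<^term>\<open>0::nat\<close> is empty, so the first term of the sequence carries no meaning; it does
  not affect the limit.
\<close>

definition has_capacity ::
  "('v \<Rightarrow> 'v \<Rightarrow> 'k::linordered_field) \<Rightarrow> ('v \<Rightarrow> 'k) \<Rightarrow> 'v \<Rightarrow> 'k \<Rightarrow> bool" where
  "has_capacity b m a c \<longleftrightarrow> converges_to (\<lambda>n. cap_on b m (graph_ball b a n) a) c"

definition null_capacity ::
  "('v \<Rightarrow> 'v \<Rightarrow> 'k::linordered_field) \<Rightarrow> ('v \<Rightarrow> 'k) \<Rightarrow> bool" where
  "null_capacity b m \<longleftrightarrow> (\<exists>a. has_capacity b m a 0)"

definition positive_capacity ::
  "('v \<Rightarrow> 'v \<Rightarrow> 'k::linordered_field) \<Rightarrow> ('v \<Rightarrow> 'k) \<Rightarrow> bool" where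
  "positive_capacity b m \<longleftrightarrow> (\<exists>a c. has_capacity b m a c \<and> c \<noteq> 0)"

definition divergent_capacity ::
  "('v \<Rightarrow> 'v \<Rightarrow> 'k::linordered_field) \<Rightarrow> ('v \<Rightarrow> 'k) \<Rightarrow> bool" where
  "divergent_capacity b m \<longleftrightarrow> (\<exists>a. \<nexists>c. has_capacity b m a c)"

definition positive_solution ::
  "('v \<Rightarrow> 'v \<Rightarrow> 'k::linordered_field) \<Rightarrow> ('v \<Rightarrow> 'k) \<Rightarrow> 'v \<Rightarrow> ('v \<Rightarrow> 'k) \<Rightarrow> bool" where
  "positive_solution b m a u \<longleftrightarrow> (\<forall>x. 0 \<le> u x) \<and> laplacian b m u = indicator {a}"

end

theory Submission
  imports Defs
begin

text \<open>
  Everything rests on the minimum principle. It makes \<open>G\<^sub>K\<close> well defined, positive and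
  increasing in \<open>K\<close>, and identifies \<open>cap\<^sub>K(a)\<close> with \<open>m(a) / G\<^sub>K(a,a)\<close>. By a Harnack
  inequality, a positive function that is superharmonic on a fixed finite set containing a path from
  \<open>x\<close> to \<open>y\<close> has comparable values at \<open>x\<close> and \<open>y\<close>. This applies to \<open>G\<^sub>K(\<cdot>,y)\<close>, so
  divergence to infinity does not depend on the pair of vertices, and also to the increments
  \<open>G\<^sub>L(\<cdot>,y) - G\<^sub>K(\<cdot>,y)\<close> for \<open>K \<subseteq> L\<close>, so neither does being a Cauchy sequence.
  Symmetry of \<open>m(x) G\<^sub>K(x,y)\<close> moves the second vertex.
\<close>

section \<open>Convergence in ordered fields\<close>

lemma converges_to_cong:
  assumes "\<forall>\<^sub>F n in sequentially. s n = t n"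
  shows "converges_to s l \<longleftrightarrow> converges_to t l"
proof -
  have "\<forall>c. (\<forall>\<^sub>F n in sequentially. \<bar>s n - l\<bar> \<le> c) \<longleftrightarrow> (\<forall>\<^sub>F n in sequentially. \<bar>t n - l\<bar> \<le> c)"
    using assms by (auto intro!: eventually_cong)
  then show ?thesis unfolding converges_to_def by simp
qed

lemma converges_to_const: "converges_to (\<lambda>_. c) c"
  unfolding converges_to_def by simp

lemma converges_to_add:
  assumes "converges_to s l" "converges_to t k"
  shows "converges_to (\<lambda>n. s n + t n) (l + k)"
  unfolding converges_to_def
proof (intro allI impI)
  fix c :: 'a assume "c > 0"
  then have "c / 2 > 0" by simp
  then have "\<forall>\<^sub>F n in sequentially. \<bar>s n - l\<bar> \<le> c / 2" "\<forall>\<^sub>F n in sequentially. \<bar>t n - k\<bar> \<le> c / 2"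
    using assms unfolding converges_to_def by blast+
  then show "\<forall>\<^sub>F n in sequentially. \<bar>s n + t n - (l + k)\<bar> \<le> c"
  proof eventually_elim
    case (elim n)
    have "\<bar>s n + t n - (l + k)\<bar> = \<bar>(s n - l) + (t n - k)\<bar>" by (simp add: algebra_simps)
    also have "\<dots> \<le> c / 2 + c / 2"
      using elim abs_triangle_ineq[of "s n - l" "t n - k"] by linarith
    finally show ?case by simp
  qed
qed

lemma converges_to_cmult:
  assumes "converges_to s l"
  shows "converges_to (\<lambda>n. k * s n) (k * l)"
proof (cases "k = 0")
  case True
  then show ?thesis by (simp add: converges_to_const)
next
  case False
  show ?thesis
    unfolding converges_to_def
  proof (intro allI impI)
    fix c :: 'a assume "c > 0"
    then have "c / \<bar>k\<bar> > 0" using False by simp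
    then have "\<forall>\<^sub>F n in sequentially. \<bar>s n - l\<bar> \<le> c / \<bar>k\<bar>"
      using assms unfolding converges_to_def by blast
    then show "\<forall>\<^sub>F n in sequentially. \<bar>k * s n - k * l\<bar> \<le> c"
    proof eventually_elim
      case (elim n)
      have "\<bar>k * s n - k * l\<bar> = \<bar>k\<bar> * \<bar>s n - l\<bar>"
        by (simp add: abs_mult[symmetric] algebra_simps)
      also have "\<dots> \<le> c" using elim False by (simp add: pos_le_divide_eq mult.commute)
      finally show ?case .
    qed
  qed
qed

lemma converges_to_sum:
  assumes "finite I" "\<And>i. i \<in> I \<Longrightarrow> converges_to (\<lambda>n. f i n) (l i)"
  shows "converges_to (\<lambda>n. \<Sum>i\<in>I. f i n) (\<Sum>i\<in>I. l i)"
  using assms by (induction I) (auto intro: converges_to_const converges_to_add)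

lemma converges_to_le:
  assumes "converges_to s l" "converges_to t k" "\<forall>\<^sub>F n in sequentially. s n \<le> t n"
  shows "l \<le> k"
proof (rule ccontr)
  assume "\<not> l \<le> k"
  \<comment> \<open>With both sequences within a third of the gap of their limits,
    \<open>s n \<le> t n\<close> would bound the gap by two thirds of itself.\<close>
  then have "(l - k) / 3 > 0" by simp
  then have "\<forall>\<^sub>F n in sequentially. \<bar>s n - l\<bar> \<le> (l - k) / 3"
      "\<forall>\<^sub>F n in sequentially. \<bar>t n - k\<bar> \<le> (l - k) / 3"
    using assms unfolding converges_to_def by blast+
  with assms(3) have "\<forall>\<^sub>F n in sequentially. l - k \<le> 2 * ((l - k) / 3)"
  proof eventually_elim
    case (elim n)
    then show ?case by linarith
  qed
  then have "l - k \<le> 2 * ((l - k) / 3)" by simp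
  with \<open>\<not> l \<le> k\<close> show False by (simp add: field_simps)
qed

lemma converges_to_unique:
  assumes "converges_to s l" "converges_to s k"
  shows "l = k"
  using converges_to_le[OF assms] converges_to_le[OF assms(2,1)] by simp

lemma converges_to_divide:
  assumes "converges_to s l" "l \<noteq> 0"
  shows "converges_to (\<lambda>n. k / s n) (k / l)"
proof -
  have "converges_to (\<lambda>n. inverse (s n)) (inverse l)"
    unfolding converges_to_def
  proof (intro allI impI)
    fix c :: 'a assume "c > 0"
    \<comment> \<open>The first entry keeps \<open>\<bar>s n\<bar>\<close> above
      \<open>\<bar>l\<bar> / 2\<close>; the second is the tolerance \<open>c\<close> multiplied by
      the resulting lower bound for \<open>\<bar>s n\<bar> * \<bar>l\<bar>\<close>, the common
      denominator of the two inverses.\<close>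
    define d where "d = min (\<bar>l\<bar> / 2) (c * (\<bar>l\<bar> / 2 * \<bar>l\<bar>))"
    have "\<bar>l\<bar> > 0" using assms(2) by simp
    then have "d > 0" using \<open>c > 0\<close> unfolding d_def by (simp del: zero_less_abs_iff abs_mult_self_eq)
    then have "\<forall>\<^sub>F n in sequentially. \<bar>s n - l\<bar> \<le> d"
      using assms(1) unfolding converges_to_def by blast
    then show "\<forall>\<^sub>F n in sequentially. \<bar>inverse (s n) - inverse l\<bar> \<le> c"
    proof eventually_elim
      case (elim n)
      have "\<bar>s n - l\<bar> \<le> \<bar>l\<bar> / 2" using elim by (simp add: d_def)
      then have half: "\<bar>l\<bar> / 2 \<le> \<bar>s n\<bar>" using abs_triangle_ineq2[of l "s n"]
        by (simp add: abs_minus_commute field_simps)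
      then have s: "s n \<noteq> 0" using assms(2) by auto
      have "\<bar>inverse (s n) - inverse l\<bar> * (\<bar>s n\<bar> * \<bar>l\<bar>) = \<bar>s n - l\<bar>"
        using s assms(2) by (simp add: abs_mult[symmetric] field_simps abs_minus_commute)
      also have "\<dots> \<le> c * (\<bar>l\<bar> / 2 * \<bar>l\<bar>)" using elim by (simp add: d_def)
      also have "\<dots> \<le> c * (\<bar>s n\<bar> * \<bar>l\<bar>)"
        using half \<open>c > 0\<close> by (intro mult_left_mono mult_right_mono) auto
      finally show ?case using s assms(2) by (simp add: mult_le_cancel_right)
    qed
  qed
  then show ?thesis using converges_to_cmult[of _ _ k] by (simp add: divide_inverse)
qed

lemma converges_to_divide_0_iff:
  fixes s :: "nat \<Rightarrow> 'a::linordered_field"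
  assumes "k > 0" and pos: "\<forall>\<^sub>F n in sequentially. s n > 0"
  shows "converges_to (\<lambda>n. k / s n) 0 \<longleftrightarrow> filterlim s at_top sequentially"
proof
  assume lim: "converges_to (\<lambda>n. k / s n) 0"
  show "filterlim s at_top sequentially"
    unfolding filterlim_at_top
  proof
    fix Z :: 'a
    \<comment> \<open>The maximum with 1 makes the bound positive, so that \<open>k / c\<close> is
      an admissible tolerance.\<close>
    define c where "c = max Z 1"
    have "c > 0" by (auto simp: c_def)
    then have "k / c > 0" using assms(1) by simp
    then have "\<forall>\<^sub>F n in sequentially. \<bar>k / s n - 0\<bar> \<le> k / c"
      using lim unfolding converges_to_def by blast
    with pos show "\<forall>\<^sub>F n in sequentially. Z \<le> s n"
    proof eventually_elim
      case (elim n)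
      then have "k / s n \<le> k / c" using assms(1) by simp
      then have "c \<le> s n" using elim(1) \<open>c > 0\<close> assms(1) by (simp add: field_simps)
      then show ?case by (simp add: c_def)
    qed
  qed
next
  assume lim: "filterlim s at_top sequentially"
  show "converges_to (\<lambda>n. k / s n) 0"
    unfolding converges_to_def
  proof (intro allI impI)
    fix c :: 'a assume "c > 0"
    have "\<forall>\<^sub>F n in sequentially. k / c \<le> s n" using lim unfolding filterlim_at_top by blast
    with pos show "\<forall>\<^sub>F n in sequentially. \<bar>k / s n - 0\<bar> \<le> c"
    proof eventually_elim
      case (elim n)
      then show ?case using \<open>c > 0\<close> assms(1) by (simp add: field_simps)
    qed
  qed
qed

lemma converges_to_imp_cauchy:
  assumes "converges_to s l"
  shows "is_cauchy s"
  unfolding is_cauchy_def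
proof (intro allI impI)
  fix c :: 'a assume "c > 0"
  then have "c / 2 > 0" by simp
  then obtain N where N: "\<And>n. n \<ge> N \<Longrightarrow> \<bar>s n - l\<bar> \<le> c / 2"
    using assms unfolding converges_to_def eventually_sequentially by blast
  have "\<bar>s i - s j\<bar> \<le> c" if "i \<ge> N" "j \<ge> N" for i j
  proof -
    have "\<bar>s i - s j\<bar> \<le> \<bar>s i - l\<bar> + \<bar>s j - l\<bar>"
      using abs_triangle_ineq4[of "s i - l" "s j - l"] by simp
    also have "\<dots> \<le> c / 2 + c / 2" using N that by (intro add_mono)
    finally show ?thesis by simp
  qed
  then show "\<exists>N. \<forall>i\<ge>N. \<forall>j\<ge>N. \<bar>s i - s j\<bar> \<le> c" by blast
qed

section \<open>Exhaustions\<close>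

lemma exhaustion_mono: "exhaustion K \<Longrightarrow> i \<le> j \<Longrightarrow> K i \<subseteq> K j"
  unfolding exhaustion_def by (metis lift_Suc_mono_le)

lemma exhaustion_finite: "exhaustion K \<Longrightarrow> finite (K n)"
  unfolding exhaustion_def by blast

lemma exhaustion_eventually_superset:
  assumes "exhaustion K" "finite P"
  shows "\<forall>\<^sub>F n in sequentially. P \<subseteq> K n"
proof -
  have "\<forall>\<^sub>F n in sequentially. x \<in> K n" for x
  proof -
    obtain N where "x \<in> K N" using assms(1) unfolding exhaustion_def by blast
    then show ?thesis
      using exhaustion_mono[OF assms(1)] unfolding eventually_sequentially by blast
  qed
  then have "\<forall>\<^sub>F n in sequentially. \<forall>x\<in>P. x \<in> K n"
    using assms(2) by (simp add: eventually_ball_finite)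
  then show ?thesis by (simp add: subset_eq)
qed

text \<open>Each set of one exhaustion lies in all late sets of the other, so the values along
  \<open>K\<close> and \<open>L\<close> interleave. This allows balls to be replaced by an arbitrary
  exhaustion. Monotonicity is asked only above sets containing \<open>a\<close>, because
  \<open>green\<close> at \<open>a\<close> is unspecified on other sets.\<close>

lemma converges_to_antimono_exhaustion:
  fixes F :: "'v set \<Rightarrow> 'k::linordered_field"
  assumes K: "exhaustion K" and L: "exhaustion L"
    and anti: "\<And>A B. finite B \<Longrightarrow> a \<in> A \<Longrightarrow> A \<subseteq> B \<Longrightarrow> F B \<le> F A"
    and lim: "converges_to (\<lambda>n. F (K n)) c"
  shows "converges_to (\<lambda>n. F (L n)) c"
  unfolding converges_to_def
proof (intro allI impI)
  fix e :: 'k assume "e > 0"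
  then have "\<forall>\<^sub>F n in sequentially. \<bar>F (K n) - c\<bar> \<le> e" using lim unfolding converges_to_def by blast
  moreover have "\<forall>\<^sub>F n in sequentially. {a} \<subseteq> K n"
    by (rule exhaustion_eventually_superset[OF K]) simp
  ultimately have "\<forall>\<^sub>F n in sequentially. \<bar>F (K n) - c\<bar> \<le> e \<and> a \<in> K n"
    by eventually_elim simp
  then obtain N where N: "\<bar>F (K N) - c\<bar> \<le> e" "a \<in> K N"
    unfolding eventually_sequentially by blast
  \<comment> \<open>For fixed \<open>n\<close> the values \<open>F (K j)\<close> are eventually
    below \<open>F (L n)\<close>; letting \<open>j\<close> grow keeps the inequality for the limit
    \<open>c\<close>.\<close>
  have lower: "c \<le> F (L n)" if "a \<in> L n" for n
  proof -
    have "\<forall>\<^sub>F j in sequentially. L n \<subseteq> K j"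
      by (rule exhaustion_eventually_superset[OF K exhaustion_finite[OF L]])
    then have "\<forall>\<^sub>F j in sequentially. F (K j) \<le> F (L n)"
      by eventually_elim (use that in \<open>auto intro: anti exhaustion_finite[OF K]\<close>)
    then show ?thesis by (rule converges_to_le[OF lim converges_to_const])
  qed
  have "\<forall>\<^sub>F n in sequentially. K N \<subseteq> L n"
    by (rule exhaustion_eventually_superset[OF L exhaustion_finite[OF K]])
  then show "\<forall>\<^sub>F n in sequentially. \<bar>F (L n) - c\<bar> \<le> e"
  proof eventually_elim
    case (elim n)
    have "F (L n) \<le> F (K N)" using N(2) elim by (intro anti exhaustion_finite[OF L])
    moreover have "c \<le> F (L n)" using N(2) elim by (intro lower) auto
    ultimately show ?case using N(1) by simp
  qed
qed

section \<open>The minimum principle and Green functions\<close>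

locale infinite_graph = weighted_graph b m
  for b :: "'v \<Rightarrow> 'v \<Rightarrow> 'k::linordered_field" and m :: "'v \<Rightarrow> 'k" +
  assumes infinite_vertices: "infinite (UNIV :: 'v set)"
    and locally_finite: "locally_finite_graph b"
    and connected: "connected_graph b"
begin

section \<open>Elementary properties of the Laplacian and the minimum principle\<close>

lemma finite_neighbours: "finite {y. adjacent b x y}"
  using locally_finite unfolding locally_finite_graph_def by blast

lemma weight_pos: "adjacent b x y \<Longrightarrow> 0 < b x y"
  using weight_nonneg[of x y] unfolding adjacent_def by simp

lemma laplacian_linear:
  "laplacian b m (\<lambda>x. f x + t * g x) x = laplacian b m f x + t * laplacian b m g x"
proof -
  have "(\<Sum>y | adjacent b x y. (f x + t * g x - (f y + t * g y)) * b x y) =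
      (\<Sum>y | adjacent b x y. (f x - f y) * b x y) + t * (\<Sum>y | adjacent b x y. (g x - g y) * b x y)"
    by (simp add: sum_distrib_left sum.distrib[symmetric] algebra_simps)
  then show ?thesis unfolding laplacian_def by (simp add: algebra_simps)
qed

lemma laplacian_cmult: "laplacian b m (\<lambda>x. t * g x) x = t * laplacian b m g x"
  using laplacian_linear[of "\<lambda>_. 0" t g x] by (simp add: laplacian_def)

lemma laplacian_diff:
  "laplacian b m (\<lambda>x. f x - g x) x = laplacian b m f x - laplacian b m g x"
  using laplacian_linear[of f "-1" g x] by simp

text \<open>At a global minimum every summand of the Laplacian is nonpositive while their sum is
  nonnegative. Hence no single summand is negative, and the positive weight of the edge forces
  equality.\<close>

lemma superharmonic_minimum:
  assumes "0 \<le> laplacian b m f x" "\<And>y. f x \<le> f y" "adjacent b x y"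
  shows "f y = f x"
proof -
  have terms: "(f x - f z) * b x z \<le> 0" for z
    using assms(2)[of z] weight_nonneg[of x z] by (simp add: mult_nonpos_nonneg)
  have "0 \<le> (\<Sum>y | adjacent b x y. (f x - f y) * b x y)"
    using assms(1) measure_pos[of x] unfolding laplacian_def by (simp add: zero_le_mult_iff zero_le_divide_iff)
  moreover have "(\<Sum>y | adjacent b x y. (f x - f y) * b x y) \<le> (f x - f y) * b x y"
    using sum_nonpos[of "{y. adjacent b x y} - {y}" "\<lambda>y. (f x - f y) * b x y"] terms assms(3)
    by (simp add: sum.remove[OF finite_neighbours, of y])
  ultimately have "0 \<le> (f x - f y) * b x y" by linarith
  then have "f y \<le> f x" using weight_pos[OF assms(3)] by (simp add: zero_le_mult_iff)
  then show ?thesis using assms(2)[of y] by simp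
qed

text \<open>A negative minimum over \<open>F\<close> would be a global one, since values outside
  \<open>F\<close> are nonnegative. Every vertex with this value lies in \<open>F\<close>, so
  \<open>superharmonic_minimum\<close> spreads it along paths to the whole graph, including a vertex
  outside the finite set \<open>F\<close>, where the value cannot be negative.\<close>

lemma minimum_principle:
  assumes "finite F" "\<And>x. x \<in> F \<Longrightarrow> 0 \<le> laplacian b m f x" "\<And>x. x \<notin> F \<Longrightarrow> 0 \<le> f x"
  shows "0 \<le> f x"
proof (rule ccontr)
  assume neg: "\<not> 0 \<le> f x"
  then have "x \<in> F" using assms(3) by blast
  then obtain z where z: "z \<in> F" "\<And>y. y \<in> F \<Longrightarrow> f z \<le> f y"
    using arg_min_if_finite(1)[of F f] arg_min_least[of F _ f] assms(1) by (metis empty_iff)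
  then have "f z < 0" using neg \<open>x \<in> F\<close> by (meson le_less_trans not_le)
  then have min: "f z \<le> f y" for y using z(2) assms(3)[of y] by (cases "y \<in> F") auto
  have "f y = f z" for y
  proof -
    have "(adjacent b)\<^sup>*\<^sup>* z y" using connected unfolding connected_graph_def by blast
    then show ?thesis
    proof induction
      case (step y w)
      then have "y \<in> F" using assms(3)[of y] \<open>f z < 0\<close> by auto
      with step show ?case using superharmonic_minimum[of f y w] assms(2) min by simp
    qed simp
  qed
  moreover obtain y where "y \<notin> F" using infinite_vertices assms(1) ex_new_if_finite by blast
  ultimately show False using assms(3)[of y] \<open>f z < 0\<close> by (metis not_le)
qed

section \<open>Dirichlet and Poisson problems on finite sets\<close>

lemma dirichlet_unique:
  assumes "finite F" "\<And>x. x \<in> F \<Longrightarrow> laplacian b m f x = laplacian b m g x"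
    "\<And>x. x \<notin> F \<Longrightarrow> f x = g x"
  shows "f = g"
proof
  fix x
  have "0 \<le> f x - g x" by (rule minimum_principle[OF assms(1)]) (simp_all add: laplacian_diff assms)
  moreover have "0 \<le> g x - f x"
    by (rule minimum_principle[OF assms(1)]) (simp_all add: laplacian_diff assms)
  ultimately show "f x = g x" by simp
qed

text \<open>Vertices are added one at a time: the solution on \<open>F\<close> is corrected at the
  new vertex \<open>z\<close> by a multiple of a function that is harmonic on \<open>F\<close>, so
  the equations already solved stay intact.\<close>

lemma poisson_solvable:
  assumes "finite F"
  shows "\<exists>f\<in>functions_on F. \<forall>x\<in>F. laplacian b m f x = g x"
  using assms
proof (induction F arbitrary: g)
  case empty
  then show ?case by (auto simp: functions_on_def)
next
  case (insert z F)
  obtain u where u: "u \<in> functions_on F" "\<forall>x\<in>F. laplacian b m u x = g x"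
    using insert.IH[of g] by blast
  obtain w where w: "w \<in> functions_on F"
      "\<forall>x\<in>F. laplacian b m w x = - laplacian b m (indicator {z}) x"
    using insert.IH[of "\<lambda>x. - laplacian b m (indicator {z}) x"] by blast
  \<comment> \<open>\<open>w\<close> cancels the Laplacian of the indicator on \<open>F\<close>. The
    factor 1 gives the expression the shape of \<open>laplacian_linear\<close>.\<close>
  define h where "h = (\<lambda>x. indicator {z} x + 1 * w x)"
  have h_harmonic: "laplacian b m h x = 0" if "x \<in> F" for x
    using w(2) that unfolding h_def by (subst laplacian_linear) simp
  have h_out: "h x = 0" if "x \<notin> insert z F" for x
    using w(1) that by (simp add: h_def functions_on_def)
  have h_z: "h z = 1" using w(1) insert.hyps by (simp add: h_def functions_on_def)
  \<comment> \<open>Otherwise \<open>h\<close> would solve the homogeneous problem on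
    \<open>insert z F\<close> and vanish by uniqueness, against \<open>h z = 1\<close>.\<close>
  have nonzero: "laplacian b m h z \<noteq> 0"
  proof
    assume "laplacian b m h z = 0"
    then have "h = (\<lambda>_. 0)"
      using h_harmonic h_out insert.hyps(1)
      by (intro dirichlet_unique[of "insert z F"]) (auto simp: laplacian_def)
    then show False using h_z by simp
  qed
  define t where "t = (g z - laplacian b m u z) / laplacian b m h z"
  have "laplacian b m (\<lambda>x. u x + t * h x) x = g x" if "x \<in> insert z F" for x
    using that u(2) h_harmonic nonzero unfolding laplacian_linear by (auto simp: t_def)
  moreover have "(\<lambda>x. u x + t * h x) \<in> functions_on (insert z F)"
    using u(1) h_out by (auto simp: functions_on_def)
  ultimately show ?case by blast
qed

text \<open>\<open>inv_into\<close> returns a genuine preimage only for elements of the image, and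
  \<open>poisson_solvable\<close> puts the indicator there. Membership of \<open>y\<close> in
  \<open>F\<close> makes the indicator vanish outside \<open>F\<close>, as every value of
  \<open>laplacian_on\<close> does.\<close>

lemma
  assumes "finite F" "y \<in> F"
  shows green_outside: "x \<notin> F \<Longrightarrow> green b m F x y = 0"
    and laplacian_green: "x \<in> F \<Longrightarrow> laplacian b m (\<lambda>x. green b m F x y) x = indicator {y} x"
proof -
  obtain f :: "'v \<Rightarrow> 'k" where f: "f \<in> functions_on F" "\<forall>x\<in>F. laplacian b m f x = indicator {y} x"
    using poisson_solvable[OF assms(1)] by blast
  have "laplacian_on b m F f = indicator {y}"
    using f(2) assms(2) by (auto simp: laplacian_on_def fun_eq_iff indicator_def)
  then have im: "indicator {y} \<in> laplacian_on b m F ` functions_on F" using f(1) by (metis imageI)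
  have g: "(\<lambda>x. green b m F x y) = inv_into (functions_on F) (laplacian_on b m F) (indicator {y})"
    unfolding green_def laplacian_inv_def ..
  have "(\<lambda>x. green b m F x y) \<in> functions_on F" unfolding g by (rule inv_into_into[OF im])
  then show "x \<notin> F \<Longrightarrow> green b m F x y = 0" by (simp add: functions_on_def)
  have "laplacian_on b m F (\<lambda>x. green b m F x y) = indicator {y}"
    unfolding g by (rule f_inv_into_f[OF im])
  from fun_cong[OF this, of x]
  show "x \<in> F \<Longrightarrow> laplacian b m (\<lambda>x. green b m F x y) x = indicator {y} x"
    by (simp add: laplacian_on_def)
qed

lemma green_nonneg:
  assumes "finite F" "y \<in> F"
  shows "0 \<le> green b m F x y"
  by (rule minimum_principle[OF assms(1)]) (simp_all add: laplacian_green green_outside assms)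

lemma laplacian_nonpos_at_zero:
  assumes "\<And>y. 0 \<le> f y" "f x = 0"
  shows "laplacian b m f x \<le> 0"
proof -
  have "(\<Sum>y | adjacent b x y. (f x - f y) * b x y) \<le> 0"
    using assms weight_nonneg by (intro sum_nonpos) simp
  then show ?thesis using measure_pos[of x] unfolding laplacian_def by (simp add: divide_nonpos_pos)
qed

lemma green_diag_pos:
  assumes "finite F" "y \<in> F"
  shows "0 < green b m F y y"
proof -
  have "green b m F y y \<noteq> 0"
  proof
    assume "green b m F y y = 0"
    then have "laplacian b m (\<lambda>x. green b m F x y) y \<le> 0"
      by (intro laplacian_nonpos_at_zero green_nonneg[OF assms])
    then show False by (simp add: laplacian_green assms)
  qed
  then show ?thesis using green_nonneg[OF assms, of y] by simp
qed

text \<open>The difference of \<open>u\<close> and the Green function is superharmonic on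
  \<open>F\<close> and equals \<open>u\<close> outside. This comparison yields both monotonicity in
  the set and minimality of the limit.\<close>

lemma green_le_supersolution:
  assumes "finite F" "y \<in> F" "\<And>x. 0 \<le> u x" "\<And>x. x \<in> F \<Longrightarrow> indicator {y} x \<le> laplacian b m u x"
  shows "green b m F x y \<le> u x"
proof -
  have "0 \<le> u x - green b m F x y"
    by (rule minimum_principle[OF assms(1)])
      (simp_all add: laplacian_diff laplacian_green green_outside assms)
  then show ?thesis by simp
qed

lemma green_mono:
  assumes "finite L" "F \<subseteq> L" "y \<in> F"
  shows "green b m F x y \<le> green b m L x y"
  using assms finite_subset[OF assms(2,1)] laplacian_green[of L y]
  by (intro green_le_supersolution green_nonneg) (auto simp: subset_eq)

text \<open>At \<open>x \<in> L - F\<close> the inner Green function vanishes, so its Laplacian is nonpositive there.\<close>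

lemma green_increment_superharmonic:
  assumes "finite L" "F \<subseteq> L" "y \<in> F" "x \<in> L"
  shows "0 \<le> laplacian b m (\<lambda>x. green b m L x y - green b m F x y) x"
proof -
  have F: "finite F" using assms(1,2) finite_subset by blast
  have y: "y \<in> L" using assms by blast
  show ?thesis
  proof (cases "x \<in> F")
    case True
    then show ?thesis using assms F y by (simp add: laplacian_diff laplacian_green)
  next
    case False
    then have "laplacian b m (\<lambda>x. green b m F x y) x \<le> 0"
      using assms F by (intro laplacian_nonpos_at_zero green_nonneg green_outside)
    moreover have "0 \<le> laplacian b m (\<lambda>x. green b m L x y) x"
      using assms y by (simp add: laplacian_green)
    ultimately show ?thesis by (simp add: laplacian_diff)
  qed
qed

text \<open>Green's formula: the Laplacian is symmetric for the inner product weighted by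
  \<open>m\<close>. Both sides split into a diagonal part carrying the weighted degree and a double
  sum over \<open>F\<close>, each invariant under exchanging \<open>f\<close> and
  \<open>g\<close>.\<close>

lemma laplacian_symmetric:
  assumes F: "finite F" and f: "\<And>x. x \<notin> F \<Longrightarrow> f x = 0" and g: "\<And>x. x \<notin> F \<Longrightarrow> g x = 0"
  shows "(\<Sum>x\<in>F. m x * f x * laplacian b m g x) = (\<Sum>x\<in>F. m x * g x * laplacian b m f x)"
proof -
  have expand: "(\<Sum>x\<in>F. m x * f x * laplacian b m g x) =
      (\<Sum>x\<in>F. f x * g x * (\<Sum>y | adjacent b x y. b x y)) - (\<Sum>x\<in>F. \<Sum>y\<in>F. f x * g y * b x y)"
    if out: "\<And>x. x \<notin> F \<Longrightarrow> g x = 0" for f g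
  proof -
    have "m x * f x * laplacian b m g x =
        f x * g x * (\<Sum>y | adjacent b x y. b x y) - (\<Sum>y\<in>F. f x * g y * b x y)" for x
    proof -
      \<comment> \<open>The sum over \<open>F\<close> and the sum over the neighbours agree with the
        sum over the intersection: non-neighbours have weight 0, and \<open>g\<close> vanishes
        outside \<open>F\<close>.\<close>
      have "(\<Sum>y\<in>F. f x * g y * b x y) = (\<Sum>y\<in>F \<inter> {y. adjacent b x y}. f x * g y * b x y)"
        using F by (intro sum.mono_neutral_right) (auto simp: adjacent_def)
      also have "\<dots> = (\<Sum>y | adjacent b x y. f x * g y * b x y)"
        using out finite_neighbours by (intro sum.mono_neutral_left) auto
      finally have "f x * g x * (\<Sum>y | adjacent b x y. b x y) - (\<Sum>y\<in>F. f x * g y * b x y) =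
          f x * (\<Sum>y | adjacent b x y. (g x - g y) * b x y)"
        by (simp add: sum_distrib_left sum_subtractf[symmetric] algebra_simps)
      then show ?thesis using measure_pos[of x] by (simp add: laplacian_def)
    qed
    then show ?thesis by (simp add: sum_subtractf)
  qed
  have "(\<Sum>x\<in>F. \<Sum>y\<in>F. f x * g y * b x y) = (\<Sum>x\<in>F. \<Sum>y\<in>F. g x * f y * b x y)"
    by (subst sum.swap) (simp add: weight_sym mult.commute)
  moreover have "(\<Sum>x\<in>F. f x * g x * D x) = (\<Sum>x\<in>F. g x * f x * D x)" for D
    by (simp add: mult.commute)
  ultimately show ?thesis
    using expand[where f = f and g = g] expand[where f = g and g = f] f g by simp
qed

lemma green_symmetric:
  assumes F: "finite F" and x: "x \<in> F" and y: "y \<in> F"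
  shows "m x * green b m F x y = m y * green b m F y x"
proof -
  \<comment> \<open>Pairing with the Laplacian of the Green function with pole \<open>p\<close>
    evaluates at \<open>p\<close>, so Green's formula for two Green functions becomes the claimed
    symmetry.\<close>
  have eval: "(\<Sum>z\<in>F. m z * h z * laplacian b m (\<lambda>w. green b m F w p) z) = m p * h p"
    if "p \<in> F" for h p
  proof -
    have "(\<Sum>z\<in>F. m z * h z * laplacian b m (\<lambda>w. green b m F w p) z) =
        (\<Sum>z\<in>F. if z = p then m z * h z else 0)"
      using F that by (intro sum.cong) (auto simp: laplacian_green indicator_def)
    then show ?thesis using F that by simp
  qed
  show ?thesis
    using laplacian_symmetric[OF F green_outside[OF F y] green_outside[OF F x]]
      eval[OF x, of "\<lambda>z. green b m F z y"] eval[OF y, of "\<lambda>z. green b m F z x"] by simp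
qed

section \<open>Harnack inequality\<close>

text \<open>Along one edge from \<open>y\<close> to \<open>w\<close>, superharmonicity at
  \<open>y\<close> bounds \<open>u w * b y w\<close> by \<open>u y\<close> times the weighted degree
  of \<open>y\<close>. Multiplying these bounds along a path from \<open>x\<close> gives
  \<open>C\<close>, and \<open>P\<close> collects all vertices of the path but the last. Both are
  chosen before \<open>u\<close>, so the estimate is uniform along an exhaustion.\<close>

lemma harnack:
  "\<exists>C>0. \<exists>P. finite P \<and>
    (\<forall>u. (\<forall>z. 0 \<le> u z) \<longrightarrow> (\<forall>z\<in>P. 0 \<le> laplacian b m u z) \<longrightarrow> u y \<le> C * u x)"
proof -
  have "(adjacent b)\<^sup>*\<^sup>* x y" using connected unfolding connected_graph_def by blast
  then show ?thesis
  proof induction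
    case base
    show ?case by (intro exI[of _ 1] conjI exI[of _ "{}"]) auto
  next
    case (step y w)
    then obtain C P where C: "0 < C" "finite P"
      "\<And>u. (\<forall>z. 0 \<le> u z) \<Longrightarrow> (\<forall>z\<in>P. 0 \<le> laplacian b m u z) \<Longrightarrow> u y \<le> C * u x" by blast
    define D where "D = (\<Sum>z | adjacent b y z. b y z)"
    have w: "0 < b y w" using step weight_pos by blast
    also have "b y w \<le> D"
      unfolding D_def using step finite_neighbours weight_nonneg by (intro member_le_sum) auto
    finally have D: "0 < D" .
    have "u w \<le> D / b y w * C * u x"
      if u: "\<forall>z. 0 \<le> u z" "\<forall>z\<in>insert y P. 0 \<le> laplacian b m u z" for u
    proof -
      have "0 \<le> (\<Sum>z | adjacent b y z. (u y - u z) * b y z)"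
        using u(2) measure_pos[of y] by (simp add: laplacian_def zero_le_divide_iff)
      then have "(\<Sum>z | adjacent b y z. u z * b y z) \<le> u y * D"
        by (simp add: D_def sum_distrib_left sum_subtractf algebra_simps)
      moreover have "u w * b y w \<le> (\<Sum>z | adjacent b y z. u z * b y z)"
        using step finite_neighbours weight_nonneg u by (intro member_le_sum) auto
      ultimately have "u w * b y w \<le> u y * D" by linarith
      also have "\<dots> \<le> (C * u x) * D" using C(3) u D by (intro mult_right_mono) auto
      finally show ?thesis using w by (simp add: field_simps)
    qed
    moreover have "0 < D / b y w * C" using D C w by simp
    moreover have "finite (insert y P)" using C by simp
    ultimately show ?case by blast
  qed
qed

text \<open>An abstract kernel covers Green functions and their increments at once. Harnack moves
  the first argument from \<open>x\<close> to \<open>x'\<close>; symmetry then exchanges the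
  arguments so that a second application moves \<open>y\<close> to \<open>y'\<close>. Symmetry and
  superharmonicity are asked on \<open>P\<close> only, since Green functions have them only at
  vertices of the finite set.\<close>

lemma symmetric_kernel_harnack:
  "\<exists>C>0. \<exists>P. finite P \<and> {x, y, x', y'} \<subseteq> P \<and>
    (\<forall>D. (\<forall>z\<in>P. \<forall>w\<in>P. m z * D z w = m w * D w z) \<longrightarrow> (\<forall>z. \<forall>w\<in>P. 0 \<le> D z w) \<longrightarrow>
      (\<forall>z\<in>P. \<forall>w\<in>P. 0 \<le> laplacian b m (\<lambda>z. D z w) z) \<longrightarrow> D x' y' \<le> C * D x y)"
proof -
  obtain C P where C: "0 < C" "finite P"
    "\<And>u. (\<forall>z. 0 \<le> u z) \<Longrightarrow> (\<forall>z\<in>P. 0 \<le> laplacian b m u z) \<Longrightarrow> u x' \<le> C * u x"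
    using harnack[where x = x and y = x'] by blast
  obtain C' P' where C': "0 < C'" "finite P'"
    "\<And>u. (\<forall>z. 0 \<le> u z) \<Longrightarrow> (\<forall>z\<in>P'. 0 \<le> laplacian b m u z) \<Longrightarrow> u y' \<le> C' * u y"
    using harnack[where x = y and y = y'] by blast
  define Q where "Q = P \<union> P' \<union> {x, y, x', y'}"
  \<comment> \<open>The two exchanges of arguments cost the factors \<open>m y' / m x'\<close> and
    \<open>m x' / m y\<close>, whose product is \<open>m y' / m y\<close>.\<close>
  have "D x' y' \<le> m y' / m y * C' * C * D x y"
    if D: "\<forall>z\<in>Q. \<forall>w\<in>Q. m z * D z w = m w * D w z" "\<forall>z. \<forall>w\<in>Q. 0 \<le> D z w"
      "\<forall>z\<in>Q. \<forall>w\<in>Q. 0 \<le> laplacian b m (\<lambda>z. D z w) z" for D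
  proof -
    have mem: "x \<in> Q" "y \<in> Q" "x' \<in> Q" "y' \<in> Q" "P \<subseteq> Q" "P' \<subseteq> Q" by (auto simp: Q_def)
    have "D y' x' \<le> C' * D y x'" by (rule C'(3)) (use D(2,3) mem in blast)+
    have "D x' y \<le> C * D x y" by (rule C(3)) (use D(2,3) mem in blast)+
    have "m x' * D x' y' = m y' * D y' x'" using D(1) mem by blast
    also have "\<dots> \<le> m y' * (C' * D y x')"
      using \<open>D y' x' \<le> C' * D y x'\<close> measure_pos[of y'] by simp
    also have "\<dots> = m y' / m y * C' * (m y * D y x')" using measure_pos[of y] by simp
    also have "m y * D y x' = m x' * D x' y" using D(1) mem by blast
    also have "m y' / m y * C' * (m x' * D x' y) \<le> m y' / m y * C' * (m x' * (C * D x y))"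
      using \<open>D x' y \<le> C * D x y\<close> measure_pos C'(1) by (intro mult_left_mono) (auto simp: less_imp_le)
    finally have "m x' * D x' y' \<le> m x' * (m y' / m y * C' * C * D x y)" by (simp add: ac_simps)
    then show ?thesis by (rule mult_left_le_imp_le[OF _ measure_pos])
  qed
  moreover have "0 < m y' / m y * C' * C" using measure_pos C C' by simp
  moreover have "finite Q" "{x, y, x', y'} \<subseteq> Q" using C C' by (auto simp: Q_def)
  ultimately show ?thesis by blast
qed

text \<open>The first estimate carries divergence to infinity from one pair of vertices to another,
  the second the Cauchy property. The increments qualify as a kernel by \<open>green_mono\<close>
  and \<open>green_increment_superharmonic\<close>.\<close>

lemma green_harnack:
  obtains C P where "0 < C" "finite P"
    "\<forall>F. finite F \<longrightarrow> P \<subseteq> F \<longrightarrow> green b m F x' y' \<le> C * green b m F x y"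
    "\<forall>F L. finite L \<longrightarrow> P \<subseteq> F \<longrightarrow> F \<subseteq> L \<longrightarrow>
      green b m L x' y' - green b m F x' y' \<le> C * (green b m L x y - green b m F x y)"
proof -
  obtain C P where C: "0 < C" "finite P"
    "\<And>D. (\<forall>z\<in>P. \<forall>w\<in>P. m z * D z w = m w * D w z) \<Longrightarrow> (\<forall>z. \<forall>w\<in>P. 0 \<le> D z w) \<Longrightarrow>
      (\<forall>z\<in>P. \<forall>w\<in>P. 0 \<le> laplacian b m (\<lambda>z. D z w) z) \<Longrightarrow> D x' y' \<le> C * D x y"
    using symmetric_kernel_harnack[where x = x and y = y and x' = x' and y' = y'] by blast
  have "green b m F x' y' \<le> C * green b m F x y" if "finite F" "P \<subseteq> F" for F
    using that
    by (intro C(3)[of "green b m F"] ballI allI green_symmetric green_nonneg)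
      (auto simp: laplacian_green subset_eq)
  moreover have "green b m L x' y' - green b m F x' y' \<le> C * (green b m L x y - green b m F x y)"
    if L: "finite L" "P \<subseteq> F" "F \<subseteq> L" for F L
  proof (rule C(3)[of "\<lambda>x y. green b m L x y - green b m F x y"]; intro ballI allI)
    fix z w assume P: "w \<in> P"
    show "0 \<le> green b m L z w - green b m F z w"
      using green_mono[of L F w z] L P by auto
    assume "z \<in> P"
    then show "0 \<le> laplacian b m (\<lambda>z. green b m L z w - green b m F z w) z"
      using L P by (intro green_increment_superharmonic) auto
    have "finite F" using L finite_subset by blast
    then have "m z * green b m L z w = m w * green b m L w z" "m z * green b m F z w = m w * green b m F w z"
      using L P \<open>z \<in> P\<close> by (intro green_symmetric; auto)+
    then show "m z * (green b m L z w - green b m F z w) = m w * (green b m L w z - green b m F w z)"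
      by (simp add: right_diff_distrib)
  qed
  ultimately show ?thesis using that[OF C(1,2)] by simp
qed

section \<open>Transfer of limits between pairs of vertices\<close>

lemma green_at_top_transfer:
  assumes K: "exhaustion K" and lim: "filterlim (\<lambda>n. green b m (K n) x' y') at_top sequentially"
  shows "filterlim (\<lambda>n. green b m (K n) x y) at_top sequentially"
  unfolding filterlim_at_top
proof
  fix Z
  obtain C P where C: "0 < C" "finite P"
    "\<forall>F. finite F \<longrightarrow> P \<subseteq> F \<longrightarrow> green b m F x' y' \<le> C * green b m F x y"
    "\<forall>F L. finite L \<longrightarrow> P \<subseteq> F \<longrightarrow> F \<subseteq> L \<longrightarrow>
      green b m L x' y' - green b m F x' y' \<le> C * (green b m L x y - green b m F x y)"
    by (rule green_harnack[where x = x and y = y and x' = x' and y' = y'])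
  have "\<forall>\<^sub>F n in sequentially. C * Z \<le> green b m (K n) x' y'"
    using lim unfolding filterlim_at_top by blast
  moreover have "\<forall>\<^sub>F n in sequentially. P \<subseteq> K n"
    by (rule exhaustion_eventually_superset[OF K C(2)])
  ultimately show "\<forall>\<^sub>F n in sequentially. Z \<le> green b m (K n) x y"
  proof eventually_elim
    case (elim n)
    then have "C * Z \<le> C * green b m (K n) x y"
      using C(3) exhaustion_finite[OF K, of n] by (meson order_trans)
    then show ?case using C(1) by simp
  qed
qed

text \<open>A bounded increasing sequence need not converge in a non-Archimedean field, so bounding
  the values would not be enough. Comparing increments transfers the Cauchy property, and
  completeness supplies the limit.\<close>

lemma green_convergent_transfer:
  assumes K: "exhaustion K" and complete: "cauchy_complete TYPE('k)"
    and lim: "converges_to (\<lambda>n. green b m (K n) x' y') l'"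
  shows "\<exists>l. converges_to (\<lambda>n. green b m (K n) x y) l"
proof -
  obtain C P where C: "0 < C" "finite P"
    "\<forall>F. finite F \<longrightarrow> P \<subseteq> F \<longrightarrow> green b m F x y \<le> C * green b m F x' y'"
    "\<forall>F L. finite L \<longrightarrow> P \<subseteq> F \<longrightarrow> F \<subseteq> L \<longrightarrow>
      green b m L x y - green b m F x y \<le> C * (green b m L x' y' - green b m F x' y')"
    by (rule green_harnack[where x = x' and y = y' and x' = x and y' = y])
  \<comment> \<open>Besides \<open>P\<close>, the sets must contain \<open>y\<close> for the Green
    functions to be specified and monotone.\<close>
  obtain N where N: "\<And>n. n \<ge> N \<Longrightarrow> insert y P \<subseteq> K n"
    using exhaustion_eventually_superset[OF K, of "insert y P"] C(2)
    unfolding eventually_sequentially by auto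
  have "is_cauchy (\<lambda>n. green b m (K n) x y)"
    unfolding is_cauchy_def
  proof (intro allI impI)
    fix c :: 'k assume "c > 0"
    then have "c / C > 0" using C(1) by simp
    then obtain M where M: "\<And>i j. i \<ge> M \<Longrightarrow> j \<ge> M \<Longrightarrow>
        \<bar>green b m (K i) x' y' - green b m (K j) x' y'\<bar> \<le> c / C"
      using converges_to_imp_cauchy[OF lim] unfolding is_cauchy_def by metis
    have ordered: "\<bar>green b m (K j) x y - green b m (K i) x y\<bar> \<le> c"
      if ij: "i \<ge> max N M" "i \<le> j" for i j
    proof -
      have "K i \<subseteq> K j" "finite (K j)" "P \<subseteq> K i" "y \<in> K i"
        using K ij N[of i] by (auto simp: exhaustion_finite dest: exhaustion_mono)
      then have "0 \<le> green b m (K j) x y - green b m (K i) x y"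
        and le: "green b m (K j) x y - green b m (K i) x y \<le>
          C * (green b m (K j) x' y' - green b m (K i) x' y')"
        using green_mono[of "K j" "K i" y x] C(4) by auto
      then have "\<bar>green b m (K j) x y - green b m (K i) x y\<bar> \<le>
          C * (green b m (K j) x' y' - green b m (K i) x' y')" by simp
      also have "\<dots> \<le> C * (c / C)"
        using M[of j i] ij C(1) by (intro mult_left_mono) auto
      finally show ?thesis using C(1) by simp
    qed
    show "\<exists>N. \<forall>i\<ge>N. \<forall>j\<ge>N. \<bar>green b m (K i) x y - green b m (K j) x y\<bar> \<le> c"
    proof (intro exI[of _ "max N M"] allI impI)
      fix i j assume "i \<ge> max N M" "j \<ge> max N M"
      then show "\<bar>green b m (K i) x y - green b m (K j) x y\<bar> \<le> c"
        using ordered[of i j] ordered[of j i] by (cases "i \<le> j") (auto simp: abs_minus_commute)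
    qed
  qed
  then show ?thesis using complete unfolding cauchy_complete_def by blast
qed

section \<open>Capacity\<close>

text \<open>The Green function with pole \<open>a\<close>, scaled to the value 1 at
  \<open>a\<close>, is the equilibrium potential; its Laplacian at \<open>a\<close> is the scaling
  factor.\<close>

lemma cap_on_eq:
  assumes "finite F" "a \<in> F"
  shows "cap_on b m F a = m a / green b m F a a"
proof -
  define v where "v = (\<lambda>x. 1 / green b m F a a * green b m F x a)"
  have pos: "0 < green b m F a a" by (rule green_diag_pos[OF assms])
  have lap: "laplacian b m v x = indicator {a} x / green b m F a a" if "x \<in> F" for x
    using assms that unfolding v_def laplacian_cmult by (simp add: laplacian_green)
  have v: "(\<forall>x\<in>F - {a}. laplacian b m v x = 0) \<and> v a = 1 \<and> (\<forall>x. x \<notin> F \<longrightarrow> v x = 0)"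
    using lap pos assms by (auto simp: v_def green_outside)
  have "equilibrium_potential b m F a = v"
    unfolding equilibrium_potential_def
  proof (rule the_equality)
    show "(\<forall>x\<in>F - {a}. laplacian b m v x = 0) \<and> v a = 1 \<and> (\<forall>x. x \<notin> F \<longrightarrow> v x = 0)" by (rule v)
  next
    fix w assume w: "(\<forall>x\<in>F - {a}. laplacian b m w x = 0) \<and> w a = 1 \<and> (\<forall>x. x \<notin> F \<longrightarrow> w x = 0)"
    show "w = v"
    \<comment> \<open>The vertex \<open>a\<close> counts as boundary here: both functions are
      prescribed to be 1 there.\<close>
    proof (rule dirichlet_unique[of "F - {a}"])
      fix x assume "x \<notin> F - {a}"
      then show "w x = v x" using v w by (cases "x = a") auto
    qed (use assms v w in auto)
  qed
  then show ?thesis using lap[OF assms(2)] by (simp add: cap_on_def)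
qed

lemma finite_walk_endpoints: "finite {x. (adjacent b ^^ n) a x}"
proof (induction n)
  case (Suc n)
  have "{x. (adjacent b ^^ Suc n) a x} = (\<Union>y\<in>{y. (adjacent b ^^ n) a y}. {x. adjacent b y x})"
    by auto
  then show ?case using Suc finite_neighbours by simp
qed simp

lemma graph_dist_path: "(adjacent b ^^ graph_dist b x y) x y"
proof -
  have "(adjacent b)\<^sup>*\<^sup>* x y" using connected unfolding connected_graph_def by blast
  then obtain n where "(adjacent b ^^ n) x y" by (auto simp: rtranclp_power)
  then show ?thesis unfolding graph_dist_def by (rule LeastI)
qed

lemma exhaustion_graph_ball: "exhaustion (graph_ball b a)"
proof -
  \<comment> \<open>Connectedness makes the \<open>LEAST\<close> in \<open>graph_dist\<close> an
    actual walk length, so a ball consists of endpoints of walks shorter than \<open>n\<close>,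
    finitely many by local finiteness.\<close>
  have "graph_ball b a n \<subseteq> (\<Union>k<n. {x. (adjacent b ^^ k) a x})" for n
    unfolding graph_ball_def using graph_dist_path by blast
  then have "finite (graph_ball b a n)" for n
    using finite_walk_endpoints by (meson finite_UN finite_lessThan finite_subset)
  then show ?thesis unfolding exhaustion_def by (auto simp: graph_ball_def)
qed

text \<open>The quotient decreases as the finite set grows, so its limit along balls and its limit
  along \<open>K\<close> coincide, either one existing if the other does.\<close>

lemma has_capacity_iff:
  assumes K: "exhaustion K"
  shows "has_capacity b m a c \<longleftrightarrow> converges_to (\<lambda>n. m a / green b m (K n) a a) c"
proof -
  have anti: "m a / green b m B a a \<le> m a / green b m A a a"
    if "finite B" "a \<in> A" "A \<subseteq> B" for A B
    using that green_mono[of B A a a] green_diag_pos[of A a] measure_pos[of a] finite_subset[of A B]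
    by (intro divide_left_mono) auto
  \<comment> \<open>The ball of radius 0 is empty, so the capacity formula is available only
    eventually.\<close>
  have "\<forall>\<^sub>F n in sequentially. {a} \<subseteq> graph_ball b a n"
    by (rule exhaustion_eventually_superset[OF exhaustion_graph_ball]) simp
  then have "\<forall>\<^sub>F n in sequentially. cap_on b m (graph_ball b a n) a =
      m a / green b m (graph_ball b a n) a a"
    by eventually_elim (auto intro: cap_on_eq exhaustion_finite[OF exhaustion_graph_ball])
  then have "has_capacity b m a c \<longleftrightarrow>
      converges_to (\<lambda>n. m a / green b m (graph_ball b a n) a a) c"
    unfolding has_capacity_def by (rule converges_to_cong)
  then show ?thesis
    using converges_to_antimono_exhaustion[of _ _ a "\<lambda>F. m a / green b m F a a" c, OF _ _ anti]
      exhaustion_graph_ball[of a] K by blast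
qed

lemma eventually_green_diag_pos:
  assumes K: "exhaustion K"
  shows "\<forall>\<^sub>F n in sequentially. 0 < green b m (K n) a a"
proof -
  have "\<forall>\<^sub>F n in sequentially. {a} \<subseteq> K n" by (rule exhaustion_eventually_superset[OF K]) simp
  then show ?thesis by eventually_elim (auto intro: green_diag_pos exhaustion_finite[OF K])
qed

lemma has_capacity_0_iff:
  assumes "exhaustion K"
  shows "has_capacity b m a 0 \<longleftrightarrow> filterlim (\<lambda>n. green b m (K n) a a) at_top sequentially"
  unfolding has_capacity_iff[OF assms]
  by (rule converges_to_divide_0_iff[OF measure_pos eventually_green_diag_pos[OF assms]])

lemma has_capacity_nonzero_iff:
  assumes K: "exhaustion K"
  shows "(\<exists>c. has_capacity b m a c \<and> c \<noteq> 0) \<longleftrightarrow> (\<exists>l. converges_to (\<lambda>n. green b m (K n) a a) l)"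
proof
  assume "\<exists>c. has_capacity b m a c \<and> c \<noteq> 0"
  then obtain c where "converges_to (\<lambda>n. m a / green b m (K n) a a) c" "c \<noteq> 0"
    using has_capacity_iff[OF K] by blast
  \<comment> \<open>\<open>m a / (m a / g)\<close> is \<open>g\<close> for every \<open>g\<close>,
    even \<open>g = 0\<close> because division by 0 gives 0, so no index needs to be
    excluded.\<close>
  from converges_to_divide[OF this, of "m a"]
  show "\<exists>l. converges_to (\<lambda>n. green b m (K n) a a) l" using measure_pos[of a] by auto
next
  assume "\<exists>l. converges_to (\<lambda>n. green b m (K n) a a) l"
  then obtain l where l: "converges_to (\<lambda>n. green b m (K n) a a) l" by blast
  \<comment> \<open>By monotonicity the limit stays above the positive value on \<open>K N\<close>,
    hence is nonzero and may be divided by.\<close>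
  obtain N where N: "a \<in> K N" using K unfolding exhaustion_def by blast
  have "\<forall>\<^sub>F n in sequentially. n \<ge> N" by (rule eventually_ge_at_top)
  then have "\<forall>\<^sub>F n in sequentially. green b m (K N) a a \<le> green b m (K n) a a"
    by eventually_elim (intro green_mono exhaustion_finite[OF K] exhaustion_mono[OF K] N)
  then have "green b m (K N) a a \<le> l" by (rule converges_to_le[OF converges_to_const l])
  then have "l \<noteq> 0" using green_diag_pos[OF exhaustion_finite[OF K] N] by auto
  then show "\<exists>c. has_capacity b m a c \<and> c \<noteq> 0"
    using converges_to_divide[OF l, of "m a"] measure_pos[of a]
    unfolding has_capacity_iff[OF K] by (intro exI[of _ "m a / l"]) auto
qed

section \<open>The limit of the Green functions and its minimality\<close>

lemma laplacian_converges_to: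
  assumes "\<And>x. converges_to (\<lambda>n. f n x) (g x)"
  shows "converges_to (\<lambda>n. laplacian b m (f n) x) (laplacian b m g x)"
proof -
  \<comment> \<open>By local finiteness the Laplacian is a finite linear combination of values; this
    form matches the rules for sums and scalar multiples.\<close>
  have "converges_to (\<lambda>n. b x y * (f n x + (-1) * f n y)) (b x y * (g x + (-1) * g y))" for y
    by (intro converges_to_cmult converges_to_add assms)
  then have "converges_to (\<lambda>n. (f n x - f n y) * b x y) ((g x - g y) * b x y)" for y
    by (simp add: mult.commute)
  then show ?thesis
    unfolding laplacian_def by (intro converges_to_cmult converges_to_sum finite_neighbours)
qed

text \<open>Positivity and the equation hold at each vertex for all large \<open>n\<close> and
  survive the pointwise limit. A positive solution is a supersolution on every \<open>K n\<close>,
  so it dominates each Green function with pole \<open>a\<close> and therefore their limit.\<close>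

lemma green_limit_minimal:
  assumes K: "exhaustion K" and lim: "\<And>x. converges_to (\<lambda>n. green b m (K n) x a) (g x)"
  shows "positive_solution b m a g" and "positive_solution b m a u \<Longrightarrow> g x \<le> u x"
proof -
  have ev: "\<forall>\<^sub>F n in sequentially. x \<in> K n" for x
    using exhaustion_eventually_superset[OF K, of "{x}"] by simp
  have "0 \<le> g x" for x
  proof (rule converges_to_le[OF converges_to_const lim])
    show "\<forall>\<^sub>F n in sequentially. 0 \<le> green b m (K n) x a"
      using ev[of a] by eventually_elim (auto intro: green_nonneg exhaustion_finite[OF K])
  qed
  moreover have "laplacian b m g x = indicator {a} x" for x
  proof (rule converges_to_unique[OF laplacian_converges_to[OF lim]])
    have "\<forall>\<^sub>F n in sequentially. laplacian b m (\<lambda>x. green b m (K n) x a) x = indicator {a} x"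
      using ev[of a] ev[of x] by eventually_elim (auto intro: laplacian_green exhaustion_finite[OF K])
    then show "converges_to (\<lambda>n. laplacian b m (\<lambda>x. green b m (K n) x a) x) (indicator {a} x)"
      using converges_to_const by (rule converges_to_cong[THEN iffD2])
  qed
  ultimately show "positive_solution b m a g" unfolding positive_solution_def by auto
  show "g x \<le> u x" if "positive_solution b m a u"
  proof (rule converges_to_le[OF lim converges_to_const])
    show "\<forall>\<^sub>F n in sequentially. green b m (K n) x a \<le> u x"
      using ev[of a]
      by eventually_elim (use that in \<open>auto simp: positive_solution_def
        intro!: green_le_supersolution exhaustion_finite[OF K]\<close>)
  qed
qed

end

section \<open>The three capacity types in terms of limits of Green functions\<close>

theorem theorem4p11:
  fixes b :: "'v \<Rightarrow> 'v \<Rightarrow> 'k::linordered_field"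
    and m :: "'v \<Rightarrow> 'k"
    and K :: "nat \<Rightarrow> 'v set"
    and a :: 'v
  assumes "non_archimedean TYPE('k)"
    and "cauchy_complete TYPE('k)"
    and "countable_cofinality TYPE('k)"
    and "weighted_graph b m"
    and "infinite (UNIV :: 'v set)"
    and "locally_finite_graph b"
    and "connected_graph b"
    and "exhaustion K"
  shows
    "(\<forall>c. has_capacity b m a c \<longleftrightarrow> converges_to (\<lambda>n. m a / green b m (K n) a a) c) \<and>
     (null_capacity b m \<longleftrightarrow>
        (\<exists>x y. filterlim (\<lambda>n. green b m (K n) x y) at_top sequentially)) \<and>
     (null_capacity b m \<longleftrightarrow>
        (\<forall>x y. filterlim (\<lambda>n. green b m (K n) x y) at_top sequentially)) \<and>
     (positive_capacity b m \<longleftrightarrow>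
        (\<exists>x y. \<exists>l. converges_to (\<lambda>n. green b m (K n) x y) l)) \<and>
     (positive_capacity b m \<longleftrightarrow>
        (\<forall>x y. \<exists>l. converges_to (\<lambda>n. green b m (K n) x y) l)) \<and>
     (divergent_capacity b m \<longleftrightarrow>
        (\<exists>x y. (\<nexists>l. converges_to (\<lambda>n. green b m (K n) x y) l) \<and>
               \<not> filterlim (\<lambda>n. green b m (K n) x y) at_top sequentially)) \<and>
     (divergent_capacity b m \<longleftrightarrow>
        (\<forall>x y. (\<nexists>l. converges_to (\<lambda>n. green b m (K n) x y) l) \<and>
               \<not> filterlim (\<lambda>n. green b m (K n) x y) at_top sequentially)) \<and>
     (positive_capacity b m \<longrightarrow>
        (\<exists>G. (\<forall>x y. converges_to (\<lambda>n. green b m (K n) x y) (G x y)) \<and>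
             positive_solution b m a (\<lambda>x. G x a) \<and>
             (\<forall>u. positive_solution b m a u \<longrightarrow> (\<forall>x. G x a \<le> u x))))"
proof -
  interpret infinite_graph b m
    using assms by (simp add: infinite_graph_def infinite_graph_axioms_def)
  note K = \<open>exhaustion K\<close>
  \<comment> \<open>All statements about vertices and pairs reduce to two propositions at the base
    pair \<open>(a, a)\<close>, which makes the existential and universal versions agree.\<close>
  define diverges where
    "diverges \<longleftrightarrow> filterlim (\<lambda>n. green b m (K n) a a) at_top sequentially"
  define converges where "converges \<longleftrightarrow> (\<exists>l. converges_to (\<lambda>n. green b m (K n) a a) l)"
  have div_all: "filterlim (\<lambda>n. green b m (K n) x y) at_top sequentially \<longleftrightarrow> diverges" for x y
    unfolding diverges_def using green_at_top_transfer[OF K] by blast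
  have conv_all: "(\<exists>l. converges_to (\<lambda>n. green b m (K n) x y) l) \<longleftrightarrow> converges" for x y
    unfolding converges_def
    using green_convergent_transfer[OF K \<open>cauchy_complete TYPE('k)\<close>] by blast
  have null: "has_capacity b m x 0 \<longleftrightarrow> diverges" for x
    using has_capacity_0_iff[OF K, of x] div_all by simp
  have pos: "(\<exists>c. has_capacity b m x c \<and> c \<noteq> 0) \<longleftrightarrow> converges" for x
    using has_capacity_nonzero_iff[OF K, of x] conv_all by simp
  \<comment> \<open>An existing capacity is either zero or nonzero, so divergent capacity means that
    neither alternative holds.\<close>
  have "(\<exists>c. has_capacity b m x c) \<longleftrightarrow> diverges \<or> converges" for x
    using null[of x] pos[of x] by metis
  then have kinds: "null_capacity b m \<longleftrightarrow> diverges" "positive_capacity b m \<longleftrightarrow> converges"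
      "divergent_capacity b m \<longleftrightarrow> \<not> converges \<and> \<not> diverges"
    using null pos unfolding null_capacity_def positive_capacity_def divergent_capacity_def
    by blast+
  have minimal: "\<exists>G. (\<forall>x y. converges_to (\<lambda>n. green b m (K n) x y) (G x y)) \<and>
      positive_solution b m a (\<lambda>x. G x a) \<and>
      (\<forall>u. positive_solution b m a u \<longrightarrow> (\<forall>x. G x a \<le> u x))" if converges
  proof -
    obtain G where G: "\<And>x y. converges_to (\<lambda>n. green b m (K n) x y) (G x y)"
      using \<open>converges\<close> conv_all by metis
    show ?thesis
      using G green_limit_minimal[OF K, of a "\<lambda>x. G x a"] by (intro exI[of _ G]) blast
  qed
  show ?thesis
    unfolding div_all conv_all kinds using has_capacity_iff[OF K] minimal by simp
qed

end
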